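(* Let $n\ge1$ be an integer, $\beta>0$ and $0<\gamma\le1$. Let $(s,z)$ be the Nielsen–Olesen vortex profile (see context), and for an integer $m$ set $x=(\gamma-1)z-\frac{2\gamma n+m}{2r}$, $y=\gamma z-\frac{2\gamma n+m}{2r}$. Then for no integer $m$ do there exist real functions $u,v$ on $(0,\infty)$, not both identically zero, satisfying the linearized equations \begin{align*} &v''+\tfrac{v'}{r}-\tfrac{v}{r^2}+2\big(2y'u+yu'+\tfrac{1}{r}yu\big)-\gamma v s^2=0,\\ &v'y-vy'+\big(2y^2+\tfrac{\gamma}{2}s^2\big)u=0, \end{align*} with the finite-energy boundary conditions $u=u_0r^k(1+o(1))$, $v=v_0r^k(1+o(1))$ as $r\to0$ for some $k>-\tfrac12$, and exponential decay of $u,v$ (like $e^{-\sqrt\gamma\, r}$ up to powers of $r$) as $r\to\infty$. That is, in the gauge where the Higgs doublet has a single (lower) component, there is no perturbative solution of the Euler–Lagrange equations about the embedded Nielsen–Olesen ($Z_{NO}$) vortex configuration.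
   Context: The Nielsen–Olesen vortex profile $(s,z)$ with winding number $n$ consists of real functions on $(0,\infty)$ solving $s''+\frac{s'}{r}-[z^2+\frac{\beta}{2}(s^2-1)]s=0$ and $z''+\frac{z'}{r}-\frac{z}{r^2}-zs^2=0$, with $s=s_0r^n(1+o(1))$, $z=\frac nr+z_0r+o(r)$ as $r\to0$ and $s\to1$, $z\to0$ exponentially as $r\to\infty$. The lower Higgs component is $\Phi_0 s e^{in\varphi}$ and $u,v$ are the radial/azimuthal profiles of a $W$ field $\propto[u\,\mathbf e_r+iv\,\mathbf e_\varphi]e^{im\varphi}$; to lowest order in $u,v$ the other fields stay at their vortex values $s$, $x$, $y$ above. $\beta=(M_H/M_Z)^2$, $\gamma=\cos^2\theta_{\rm w}$. *)

theory Defs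
  imports "HOL-Analysis.Analysis"
begin

definition NO_vortex :: "nat \<Rightarrow> real \<Rightarrow> (real \<Rightarrow> real) \<Rightarrow> (real \<Rightarrow> real) \<Rightarrow> bool" where
  "NO_vortex n \<beta> s z \<longleftrightarrow>
     (\<forall>r>0. s differentiable (at r) \<and> deriv s differentiable (at r) \<and>
            z differentiable (at r) \<and> deriv z differentiable (at r)) \<and>
     (\<forall>r>0. deriv (deriv s) r + deriv s r / r
             - ((z r)\<^sup>2 + \<beta> / 2 * ((s r)\<^sup>2 - 1)) * s r = 0) \<and>
     (\<forall>r>0. deriv (deriv z) r + deriv z r / r - z r / r\<^sup>2 - z r * (s r)\<^sup>2 = 0) \<and>
     (\<exists>s0 \<epsilon>. (\<epsilon> \<longlongrightarrow> 0) (at_right 0) \<and>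
        (\<forall>\<^sub>F r in at_right 0. s r = s0 * r ^ n * (1 + \<epsilon> r))) \<and>
     (\<exists>z0. ((\<lambda>r. (z r - real n / r - z0 * r) / r) \<longlongrightarrow> 0) (at_right 0)) \<and>
     (\<exists>C a. a > 0 \<and> (\<forall>r\<ge>1. \<bar>s r - 1\<bar> \<le> C * exp (- a * r) \<and> \<bar>z r\<bar> \<le> C * exp (- a * r)))"

text \<open>The profile y = gamma z - (2 gamma n + m)/(2r).
  (The profile x = (gamma-1) z - (2 gamma n + m)/(2r) does not enter the
  linearised equations.)\<close>
definition y_prof :: "real \<Rightarrow> nat \<Rightarrow> int \<Rightarrow> (real \<Rightarrow> real) \<Rightarrow> real \<Rightarrow> real" where
  "y_prof \<gamma> n m z r = \<gamma> * z r - (2 * \<gamma> * real n + real_of_int m) / (2 * r)"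

definition x_prof :: "real \<Rightarrow> nat \<Rightarrow> int \<Rightarrow> (real \<Rightarrow> real) \<Rightarrow> real \<Rightarrow> real" where
  "x_prof \<gamma> n m z r = (\<gamma> - 1) * z r - (2 * \<gamma> * real n + real_of_int m) / (2 * r)"

definition W_perturbation ::
  "real \<Rightarrow> nat \<Rightarrow> int \<Rightarrow> (real \<Rightarrow> real) \<Rightarrow> (real \<Rightarrow> real) \<Rightarrow> (real \<Rightarrow> real) \<Rightarrow> (real \<Rightarrow> real) \<Rightarrow> bool" where
  "W_perturbation \<gamma> n m s z u v \<longleftrightarrow>
     (let y = y_prof \<gamma> n m z in
     (\<forall>r>0. u differentiable (at r) \<and> v differentiable (at r) \<and> deriv v differentiable (at r)) \<and>
     (\<forall>r>0. deriv (deriv v) r + deriv v r / r - v r / r\<^sup>2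
             + 2 * (2 * deriv y r * u r + y r * deriv u r + y r * u r / r)
             - \<gamma> * v r * (s r)\<^sup>2 = 0) \<and>
     (\<forall>r>0. deriv v r * y r - v r * deriv y r + (2 * (y r)\<^sup>2 + \<gamma> / 2 * (s r)\<^sup>2) * u r = 0) \<and>
     (\<exists>r>0. u r \<noteq> 0 \<or> v r \<noteq> 0) \<and>
     (\<exists>k u0 v0 \<epsilon>u \<epsilon>v. k > - 1 / 2 \<and>
        (\<epsilon>u \<longlongrightarrow> 0) (at_right 0) \<and> (\<epsilon>v \<longlongrightarrow> 0) (at_right 0) \<and>
        (\<forall>\<^sub>F r in at_right 0. u r = u0 * r powr k * (1 + \<epsilon>u r) \<and>
                                 v r = v0 * r powr k * (1 + \<epsilon>v r))) \<and>
     (\<exists>C p. \<forall>r\<ge>1. \<bar>u r\<bar> \<le> C * r powr p * exp (- sqrt \<gamma> * r) \<and>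
                   \<bar>v r\<bar> \<le> C * r powr p * exp (- sqrt \<gamma> * r)))"

end

theory Submission
  imports Defs "HOL-Real_Asymp.Real_Asymp"
begin

text \<open>With \<open>h = z' + z / r\<close>, \<open>B = v' + v / r + 2 y u\<close>, \<open>P = r s\<^sup>2 u\<close> and \<open>Q = r v\<close>, the equations
  become the linear system \<open>y B = \<gamma> h v - (\<gamma> / 2) s\<^sup>2 u\<close>, \<open>P' = - 2 x s\<^sup>2 Q\<close>, \<open>Q' = r (B - 2 y u)\<close>; the
  equation for \<open>P\<close> is current conservation and follows by differentiating the first one. Since
  \<open>(r z h)' \<ge> 0\<close>, the product \<open>r z\<close> decreases from \<open>n\<close> to \<open>0\<close> and \<open>h \<le> 0\<close>.

  If \<open>v\<close> has leading coefficient \<open>v\<^sub>0 = 0\<close> at the origin, then \<open>u = v = 0\<close> near \<open>0\<close> and hence everywhere.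
  Otherwise take \<open>v\<^sub>0 > 0\<close>. For \<open>m \<ge> 0\<close> (where \<open>x, y < 0\<close>) and for \<open>m < - 2 n\<close> (where \<open>x, y > 0\<close>) the
  system preserves a quadrant in which \<open>\<bar>P\<bar>\<close> increases from \<open>0\<close>, contradicting decay at infinity.
  For \<open>- 2 n \<le> m < 0\<close> one finds \<open>y > 0\<close> and \<open>u \<ge> 0\<close> near \<open>0\<close>, so that \<open>Q > 0\<close> would decrease from the
  limit \<open>0\<close>.\<close>

section \<open>Real analysis: monotonicity from a limit at 0, Gronwall, first zeros\<close>

lemma nondecreasing_from_zero:
  fixes f :: "real \<Rightarrow> real"
  assumes lim: "(f \<longlongrightarrow> 0) (at_right 0)"
    and der: "\<And>r. 0 < r \<Longrightarrow> r < b \<Longrightarrow> (f has_real_derivative f' r) (at r)"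
    and nonneg: "\<And>r. 0 < r \<Longrightarrow> r < b \<Longrightarrow> f' r \<ge> 0"
    and t: "0 < t" "t < b"
  shows "f t \<ge> 0"
proof (rule tendsto_upperbound[OF lim])
  show "\<forall>\<^sub>F r in at_right 0. f r \<le> f t"
    using eventually_at_right_less[of "0::real"] eventually_at_right_real[OF t(1)]
  proof eventually_elim
    case (elim r)
    then have r: "0 < r" "r < t" by auto
    show ?case
    proof (rule DERIV_nonneg_imp_nondecreasing[of r t f])
      show "\<exists>y. (f has_real_derivative y) (at q) \<and> 0 \<le> y" if "r \<le> q" "q \<le> t" for q
        using r t that der[of q] nonneg[of q] by auto
    qed (use r in simp)
  qed
qed simp

lemma increasing_from_zero:
  fixes f :: "real \<Rightarrow> real"
  assumes lim: "(f \<longlongrightarrow> 0) (at_right 0)"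
    and der: "\<And>r. 0 < r \<Longrightarrow> r < b \<Longrightarrow> (f has_real_derivative f' r) (at r)"
    and pos: "\<And>r. 0 < r \<Longrightarrow> r < b \<Longrightarrow> f' r > 0"
    and t: "0 < t" "t < b"
  shows "f t > 0"
proof -
  \<comment> \<open>The limit at 0 yields only a weak inequality; strictness is gained on the
    interval from \<open>t / 2\<close> to \<open>t\<close>.\<close>
  have "f (t / 2) \<ge> 0"
    using pos t by (intro nondecreasing_from_zero[OF lim der]) (auto intro: less_imp_le)
  moreover have "f (t / 2) < f t"
  proof (rule DERIV_pos_imp_increasing[of "t / 2" t f])
    show "\<exists>y. (f has_real_derivative y) (at q) \<and> 0 < y" if "t / 2 \<le> q" "q \<le> t" for q
      using t that der[of q] pos[of q] by auto
  qed (use t in simp)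
  ultimately show ?thesis by linarith
qed

text \<open>The integrating factor \<open>exp (- C * r)\<close> turns \<open>E\<close> into a
  nonincreasing function that starts at 0.\<close>

lemma gronwall_zero:
  fixes E :: "real \<Rightarrow> real"
  assumes "a \<le> b" and "E a = 0"
    and der: "\<And>r. a \<le> r \<Longrightarrow> r \<le> b \<Longrightarrow> (E has_real_derivative E' r) (at r)"
    and le: "\<And>r. a \<le> r \<Longrightarrow> r \<le> b \<Longrightarrow> E' r \<le> C * E r"
  shows "E b \<le> 0"
proof -
  have "E b * exp (- C * b) \<le> E a * exp (- C * a)"
  proof (rule DERIV_nonpos_imp_nonincreasing[OF \<open>a \<le> b\<close>])
    fix r assume r: "a \<le> r" "r \<le> b"
    have "((\<lambda>r. E r * exp (- C * r)) has_real_derivative (E' r - C * E r) * exp (- C * r)) (at r)"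
      by (auto intro!: derivative_eq_intros der[OF r] simp: algebra_simps)
    moreover have "(E' r - C * E r) * exp (- C * r) \<le> 0"
      using le[OF r] by (intro mult_nonpos_nonneg) auto
    ultimately show "\<exists>y. ((\<lambda>r. E r * exp (- C * r)) has_real_derivative y) (at r) \<and> y \<le> 0" by blast
  qed
  then show ?thesis using \<open>E a = 0\<close> by (simp add: mult_le_0_iff)
qed

text \<open>The zero set in \<open>{a..c}\<close> is compact and, by the intermediate value theorem,
  nonempty. Its least element is the required \<open>t\<close>, since a nonpositive value before it
  would produce an earlier zero.\<close>

lemma first_zero:
  fixes f :: "real \<Rightarrow> real"
  assumes cont: "continuous_on {a..c} f" and "a \<le> c" "f a > 0" "f c \<le> 0"
  obtains t where "a < t" "t \<le> c" "f t = 0" "\<And>r. a \<le> r \<Longrightarrow> r < t \<Longrightarrow> f r > 0"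
proof -
  let ?S = "{r \<in> {a..c}. f r = 0}"
  have "compact ?S"
    unfolding compact_eq_bounded_closed
    using continuous_closed_preimage_constant[OF cont closed_atLeastAtMost, of 0]
    by (auto intro: bounded_subset[OF bounded_closed_interval])
  moreover have "?S \<noteq> {}"
    using IVT2'[of f c 0 a] assms by auto
  ultimately obtain t where t: "t \<in> ?S" "\<And>r. r \<in> ?S \<Longrightarrow> t \<le> r"
    using compact_attains_inf[of ?S] by blast
  show thesis
  proof
    show "a < t" using t(1) \<open>f a > 0\<close> by (cases "t = a") auto
    show "t \<le> c" "f t = 0" using t(1) by auto
    fix r assume r: "a \<le> r" "r < t"
    show "f r > 0"
    proof (rule ccontr)
      assume "\<not> f r > 0"
      moreover have "continuous_on {a..r} f"
        using r t(1) by (intro continuous_on_subset[OF cont]) auto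
      ultimately obtain q where "a \<le> q" "q \<le> r" "f q = 0"
        using IVT2'[of f r 0 a] r \<open>f a > 0\<close> by auto
      then show False using t(2)[of q] t(1) r by auto
    qed
  qed
qed

lemma DERIV_continuous_on_Icc:
  fixes f :: "real \<Rightarrow> real"
  assumes "a > 0" and "\<And>r. r > 0 \<Longrightarrow> (f has_real_derivative f' r) (at r)"
  shows "continuous_on {a..b} f"
proof (rule DERIV_continuous_on)
  show "(f has_real_derivative f' r) (at r within {a..b})" if "r \<in> {a..b}" for r
    using assms that by (simp add: has_field_derivative_at_within)
qed

lemma continuous_on_Icc_bounded:
  fixes f :: "real \<Rightarrow> real"
  assumes "continuous_on {a..b} f"
  obtains M where "M \<ge> 0" "\<And>r. a \<le> r \<Longrightarrow> r \<le> b \<Longrightarrow> \<bar>f r\<bar> \<le> M"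
proof -
  have "bounded (f ` {a..b})"
    using assms by (intro compact_imp_bounded compact_continuous_image) auto
  then obtain M where "M > 0" "\<forall>y \<in> f ` {a..b}. norm y \<le> M"
    unfolding bounded_pos by blast
  then show thesis using that[of M] by simp
qed

section \<open>The Nielsen-Olesen profile: field equations and limits\<close>

locale vortex =
  fixes n :: nat and \<beta> :: real and s z :: "real \<Rightarrow> real"
  assumes n: "n \<ge> 1" and vortex: "NO_vortex n \<beta> s z"
begin

text \<open>This is the curl of the azimuthal field with profile \<open>z\<close>, that is, its
  magnetic field. In terms of \<open>h\<close> and \<open>Z\<close> the equation for
  \<open>z\<close> becomes the first-order system \<open>Z' = r h\<close>,
  \<open>h' = z s^2\<close>.\<close>

definition h :: "real \<Rightarrow> real" where "h r = deriv z r + z r / r"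
definition Z :: "real \<Rightarrow> real" where "Z r = r * z r"

lemma ds: "r > 0 \<Longrightarrow> (s has_real_derivative deriv s r) (at r)"
  and ds': "r > 0 \<Longrightarrow> (deriv s has_real_derivative deriv (deriv s) r) (at r)"
  and dz: "r > 0 \<Longrightarrow> (z has_real_derivative deriv z r) (at r)"
  and dz': "r > 0 \<Longrightarrow> (deriv z has_real_derivative deriv (deriv z) r) (at r)"
  using conjunct1[OF vortex[unfolded NO_vortex_def], rule_format, of r]
  unfolding DERIV_deriv_iff_real_differentiable by simp_all

lemma dZ: "r > 0 \<Longrightarrow> (Z has_real_derivative r * h r) (at r)"
  unfolding Z_def h_def by (auto intro!: derivative_eq_intros dz simp: algebra_simps)

lemma dh: assumes "r > 0" shows "(h has_real_derivative z r * (s r)\<^sup>2) (at r)"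
proof -
  have "deriv (deriv z) r + deriv z r / r - z r / r\<^sup>2 - z r * (s r)\<^sup>2 = 0"
    using vortex assms unfolding NO_vortex_def by blast
  moreover have "(h has_real_derivative deriv (deriv z) r + (deriv z r * r - z r) / (r * r)) (at r)"
    unfolding h_def using assms by (auto intro!: derivative_eq_intros dz dz')
  moreover have "(deriv z r * r - z r) / (r * r) = deriv z r / r - z r / r\<^sup>2"
    using assms by (simp add: field_simps power2_eq_square)
  ultimately show ?thesis by (auto elim!: DERIV_cong)
qed

lemma s_eq: "r > 0 \<Longrightarrow> deriv (deriv s) r = - deriv s r / r + ((z r)\<^sup>2 + \<beta> / 2 * ((s r)\<^sup>2 - 1)) * s r"
  using conjunct1[OF conjunct2[OF vortex[unfolded NO_vortex_def]], rule_format, of r] by simp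

lemma continuous_on_field:
  assumes "a > 0"
  shows "continuous_on {a..b} s" "continuous_on {a..b} z"
    "continuous_on {a..b} h"
proof -
  show "continuous_on {a..b} s" by (rule DERIV_continuous_on_Icc[OF assms ds])
  show "continuous_on {a..b} z" by (rule DERIV_continuous_on_Icc[OF assms dz])
  show "continuous_on {a..b} h" by (rule DERIV_continuous_on_Icc[OF assms dh])
qed

lemma exp_decay_at_top:
  assumes "(a::real) > 0" shows "((\<lambda>r. C * r powr p * exp (- a * r)) \<longlongrightarrow> 0) at_top"
proof -
  have "((\<lambda>r. C * (r powr p * exp (- a * r))) \<longlongrightarrow> C * 0) at_top"
    using assms by (intro tendsto_mult_left) real_asymp
  then show ?thesis by (simp add: mult.assoc)
qed

lemma s_at_top: "(s \<longlongrightarrow> 1) at_top"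
proof -
  obtain C a where a: "a > 0" and C: "\<And>r. r \<ge> 1 \<Longrightarrow> \<bar>s r - 1\<bar> \<le> C * exp (- a * r)"
    using vortex unfolding NO_vortex_def by blast
  have "((\<lambda>r. s r - 1) \<longlongrightarrow> 0) at_top"
  proof (rule Lim_null_comparison)
    show "\<forall>\<^sub>F r in at_top. norm (s r - 1) \<le> C * r powr 0 * exp (- a * r)"
      using eventually_ge_at_top[of 1] by eventually_elim (use C in auto)
  qed (rule exp_decay_at_top[OF a])
  then show ?thesis by (simp add: LIM_zero_iff)
qed

lemma Z_at_top: "(Z \<longlongrightarrow> 0) at_top"
proof -
  obtain C a where a: "a > 0" and C: "\<And>r. r \<ge> 1 \<Longrightarrow> \<bar>z r\<bar> \<le> C * exp (- a * r)"
    using vortex unfolding NO_vortex_def by blast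
  show ?thesis
  proof (rule Lim_null_comparison)
    show "\<forall>\<^sub>F r in at_top. norm (Z r) \<le> C * r powr 1 * exp (- a * r)"
      using eventually_ge_at_top[of 1]
    proof eventually_elim
      case (elim r)
      then have "r * \<bar>z r\<bar> \<le> r * (C * exp (- a * r))" by (intro mult_left_mono C) auto
      then show ?case using elim by (simp add: Z_def abs_mult mult_ac)
    qed
  qed (rule exp_decay_at_top[OF a])
qed

lemma Z_at_0: "(Z \<longlongrightarrow> real n) (at_right 0)"
proof -
  obtain z0 where "((\<lambda>r. (z r - real n / r - z0 * r) / r) \<longlongrightarrow> 0) (at_right 0)"
    using vortex unfolding NO_vortex_def by blast
  then have "((\<lambda>r. (z r - real n / r - z0 * r) / r * r\<^sup>2 + real n + z0 * r\<^sup>2) \<longlongrightarrow> 0 * 0\<^sup>2 + real n + z0 * 0\<^sup>2)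
      (at_right 0)"
    by (intro tendsto_intros)
  then have "((\<lambda>r. (z r - real n / r - z0 * r) / r * r\<^sup>2 + real n + z0 * r\<^sup>2) \<longlongrightarrow> real n) (at_right 0)"
    by simp
  then show ?thesis
  proof (rule Lim_transform_eventually)
    show "\<forall>\<^sub>F r in at_right 0. (z r - real n / r - z0 * r) / r * r\<^sup>2 + real n + z0 * r\<^sup>2 = Z r"
      using eventually_at_right_less[of "0::real"]
      by eventually_elim (auto simp: Z_def field_simps power2_eq_square)
  qed
qed

text \<open>The equation for \<open>s\<close> is a linear second-order equation once
  \<open>V\<close> is regarded as given. After a double zero, Gronwall for \<open>s^2 + s'^2\<close>
  keeps \<open>s\<close> at 0 all the way to infinity, against the limit 1. Going forward in
  \<open>r\<close>, the friction term \<open>- s' / r\<close> has the favourable sign.\<close>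

lemma s_zero_simple:
  assumes "T > 0" "s T = 0" shows "deriv s T \<noteq> 0"
proof
  assume s': "deriv s T = 0"
  define V where "V r = (z r)\<^sup>2 + \<beta> / 2 * ((s r)\<^sup>2 - 1)" for r
  have "s R = 0" if "R \<ge> T" for R
  proof -
    have "continuous_on {T..R} V"
      unfolding V_def by (intro continuous_intros continuous_on_field \<open>T > 0\<close>)
    then obtain M where "M \<ge> 0" and M: "\<And>r. T \<le> r \<Longrightarrow> r \<le> R \<Longrightarrow> \<bar>V r\<bar> \<le> M"
      using continuous_on_Icc_bounded by blast
    have "(s R)\<^sup>2 + (deriv s R)\<^sup>2 \<le> 0"
    proof (rule gronwall_zero[of T R _ _ "1 + M"])
      fix r assume r: "T \<le> r" "r \<le> R"
      have r0: "r > 0" using r \<open>T > 0\<close> by simp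
      show "((\<lambda>r. (s r)\<^sup>2 + (deriv s r)\<^sup>2) has_real_derivative
          2 * s r * deriv s r + 2 * deriv s r * deriv (deriv s) r) (at r)"
        by (auto intro!: derivative_eq_intros ds[OF r0] ds'[OF r0])
      have "2 * s r * deriv s r + 2 * deriv s r * deriv (deriv s) r
          = - 2 * (deriv s r)\<^sup>2 / r + (1 + V r) * (2 * s r * deriv s r)"
        using r0 by (simp add: s_eq V_def field_simps power2_eq_square)
      also have "\<dots> \<le> (1 + V r) * (2 * s r * deriv s r)"
        using r0 by simp
      also have "\<dots> \<le> \<bar>1 + V r\<bar> * \<bar>2 * s r * deriv s r\<bar>"
        by (metis abs_ge_self abs_mult)
      also have "\<dots> \<le> (1 + M) * ((s r)\<^sup>2 + (deriv s r)\<^sup>2)"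
      proof (intro mult_mono)
        show "\<bar>2 * s r * deriv s r\<bar> \<le> (s r)\<^sup>2 + (deriv s r)\<^sup>2"
          using sum_squares_bound[of "\<bar>s r\<bar>" "\<bar>deriv s r\<bar>"] by (simp add: abs_mult)
      qed (use M[OF r] in auto)
      finally show "2 * s r * deriv s r + 2 * deriv s r * deriv (deriv s) r
        \<le> (1 + M) * ((s r)\<^sup>2 + (deriv s r)\<^sup>2)" .
    qed (use that assms s' in auto)
    then show "s R = 0" by (simp add: sum_power2_le_zero_iff)
  qed
  then have "\<forall>\<^sub>F r in at_top. s r = 0" by (auto intro: eventually_at_top_linorderI)
  then have "(s \<longlongrightarrow> 0) at_top" by (rule tendsto_eventually)
  then show False using tendsto_unique[OF _ s_at_top, of 0] by simp
qed

text \<open>The midpoint of such an interval would be a double zero.\<close>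

lemma s_not_locally_zero:
  assumes "0 \<le> a" "a < b" "\<And>r. a < r \<Longrightarrow> r < b \<Longrightarrow> s r = 0" shows False
proof -
  define T where "T = (a + b) / 2"
  have T: "a < T" "T < b" "T > 0" using assms by (auto simp: T_def)
  have "(s has_real_derivative 0) (at T)"
    by (rule has_field_derivative_transform_within_open[of "\<lambda>_. 0" _ _ "{a<..<b}"])
      (use assms T in auto)
  then have "deriv s T = 0" by (rule DERIV_imp_deriv)
  then show False using s_zero_simple[of T] assms T by auto
qed

section \<open>Monotonicity of \<open>Z\<close> and the sign of \<open>h\<close>\<close>

lemma Zh_nonpos: assumes "a > 0" shows "Z a * h a \<le> 0"
proof (rule ccontr)
  assume "\<not> ?thesis"
  then have pos: "Z a * h a > 0" by simp
  \<comment> \<open>The derivative of \<open>Z h\<close> is \<open>r h^2 + r (z s)^2\<close>, so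
    positivity persists beyond \<open>a\<close>. Then \<open>Z^2\<close>, whose derivative is
    \<open>2 r Z h\<close>, cannot decay to 0.\<close>
  have Zh: "Z r * h r > 0" if "r \<ge> a" for r
  proof -
    have "Z a * h a \<le> Z r * h r"
    proof (rule DERIV_nonneg_imp_nondecreasing[OF that])
      fix t assume "a \<le> t" "t \<le> r"
      then have t: "t > 0" using assms by simp
      have "((\<lambda>t. Z t * h t) has_real_derivative t * (h t)\<^sup>2 + t * (z t * s t)\<^sup>2) (at t)"
          by (rule DERIV_cong[OF DERIV_mult[OF dZ[OF t] dh[OF t]]])
          (simp add: Z_def power2_eq_square algebra_simps)
      then show "\<exists>y. ((\<lambda>t. Z t * h t) has_real_derivative y) (at t) \<and> 0 \<le> y"
        using t by (intro exI conjI) auto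
    qed
    then show ?thesis using pos by simp
  qed
  have "(Z a)\<^sup>2 \<le> (Z r)\<^sup>2" if "r \<ge> a" for r
  proof (rule DERIV_nonneg_imp_nondecreasing[OF that])
    fix t assume t: "a \<le> t" "t \<le> r"
    then have t0: "t > 0" using assms by simp
    have "((\<lambda>t. (Z t)\<^sup>2) has_real_derivative 2 * t * (Z t * h t)) (at t)"
      by (auto intro!: derivative_eq_intros dZ[OF t0])
    then show "\<exists>y. ((\<lambda>t. (Z t)\<^sup>2) has_real_derivative y) (at t) \<and> 0 \<le> y"
      using t0 Zh[OF t(1)] by (intro exI conjI) auto
  qed
  then have "(Z a)\<^sup>2 \<le> 0\<^sup>2"
    by (intro tendsto_lowerbound[OF tendsto_power[OF Z_at_top]] eventually_at_top_linorderI[of a]) auto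
  then show False using pos by simp
qed

lemma Z_sq_antimono: assumes "0 < a" "a \<le> b" shows "(Z b)\<^sup>2 \<le> (Z a)\<^sup>2"
proof (rule DERIV_nonpos_imp_nonincreasing[OF assms(2)])
  fix t assume t: "a \<le> t" "t \<le> b"
  then have t0: "t > 0" using assms by simp
  have "((\<lambda>t. (Z t)\<^sup>2) has_real_derivative 2 * t * (Z t * h t)) (at t)"
    by (auto intro!: derivative_eq_intros dZ[OF t0])
  then show "\<exists>y. ((\<lambda>t. (Z t)\<^sup>2) has_real_derivative y) (at t) \<and> y \<le> 0"
    using t0 Zh_nonpos[OF t0] by (intro exI conjI) (auto simp: mult_le_0_iff)
qed

text \<open>Near 0 the function is close to \<open>n > 0\<close>. Before turning negative it would
  pass through a zero, after which the nonincreasing \<open>Z^2\<close> stays 0.\<close>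

lemma Z_nonneg: assumes "r > 0" shows "Z r \<ge> 0"
proof (rule ccontr)
  assume neg: "\<not> ?thesis"
  have "\<forall>\<^sub>F a in at_right 0. Z a > 0"
    using order_tendstoD(1)[OF Z_at_0, of 0] n by simp
  then obtain a where a: "0 < a" "a < r" "Z a > 0"
    using assms unfolding eventually_at_right_field
    by (metis dense min_less_iff_conj)
  have "continuous_on {a..r} Z"
    by (rule DERIV_continuous_on_Icc[OF a(1) dZ])
  then obtain q where "a \<le> q" "q \<le> r" "Z q = 0"
    using IVT2'[of Z r 0 a] neg a by auto
  then show False using Z_sq_antimono[of q r] a neg by auto
qed

text \<open>Where \<open>Z > 0\<close>, the sign is that of \<open>Z h\<close>. A zero of
  \<open>Z\<close> is a minimum of a nonnegative function, so there the derivative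
  \<open>r h\<close> vanishes.\<close>

lemma h_nonpos: assumes r: "r > 0" shows "h r \<le> 0"
proof (cases "Z r = 0")
  case True
  have "r * h r = 0"
    by (rule DERIV_local_min[OF dZ[OF r] r]) (use Z_nonneg True in \<open>auto simp: abs_less_iff\<close>)
  then show ?thesis using r by simp
next
  case False
  then show ?thesis using Z_nonneg[OF r] Zh_nonpos[OF r] by (simp add: mult_le_0_iff)
qed

lemma Z_antimono: assumes "0 < a" "a \<le> b" shows "Z b \<le> Z a"
  by (rule power2_le_imp_le[OF Z_sq_antimono[OF assms] Z_nonneg[OF assms(1)]])

lemma Z_le: assumes "r > 0" shows "Z r \<le> n"
proof (rule tendsto_lowerbound[OF Z_at_0])
  show "\<forall>\<^sub>F a in at_right 0. Z r \<le> Z a"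
    using eventually_at_right_less[of 0] eventually_at_right_real[OF assms]
    by eventually_elim (auto intro: Z_antimono)
qed simp

text \<open>If the bound \<open>n\<close> were attained at \<open>r\<close>, then \<open>Z\<close>
  would be constant on the interval from 0 to \<open>r\<close>, so \<open>h\<close> and
  \<open>h' = z s^2\<close> would vanish there, and with them \<open>s\<close>. The strictness makes
  \<open>y\<close> negative in the case \<open>m = 0\<close>.\<close>

lemma Z_less: assumes "r > 0" shows "Z r < n"
proof (rule ccontr)
  assume "\<not> ?thesis"
  then have eq: "Z r = n" using Z_le[OF assms] by simp
  have Zc: "Z t = n" if "0 < t" "t < r" for t
    using Z_le[of t] Z_antimono[of t r] that eq by simp
  have h0: "h t = 0" if t: "0 < t" "t < r" for t
  proof -
    have "(Z has_real_derivative 0) (at t)"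
      by (rule has_field_derivative_transform_within_open[of "\<lambda>_. real n" _ _ "{0<..<r}"])
        (use Zc t in auto)
    then have "t * h t = 0" using DERIV_unique dZ[OF t(1)] by blast
    then show ?thesis using t by simp
  qed
  have "s t = 0" if t: "0 < t" "t < r" for t
  proof -
    have "(h has_real_derivative 0) (at t)"
      by (rule has_field_derivative_transform_within_open[of "\<lambda>_. 0" _ _ "{0<..<r}"])
        (use h0 t in auto)
    then have "z t * (s t)\<^sup>2 = 0" using DERIV_unique dh[OF t(1)] by blast
    then show ?thesis using Zc[OF t] n by (auto simp: Z_def)
  qed
  then show False using s_not_locally_zero[of 0 r] assms by simp
qed

section \<open>The Higgs profile near the origin and near its zeros\<close>

lemma s_near_0:
  obtains s0 \<epsilon> where "s0 \<noteq> 0" "(\<epsilon> \<longlongrightarrow> 0) (at_right 0)"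
    "\<forall>\<^sub>F r in at_right 0. s r = s0 * r ^ n * (1 + \<epsilon> r)"
proof -
  obtain s0 \<epsilon> where e: "(\<epsilon> \<longlongrightarrow> 0) (at_right 0)"
    "\<forall>\<^sub>F r in at_right 0. s r = s0 * r ^ n * (1 + \<epsilon> r)"
    using vortex unfolding NO_vortex_def by blast
  \<comment> \<open>The asymptotic law is multiplicative, so \<open>s0 = 0\<close> would make
    \<open>s\<close> vanish identically near 0.\<close>
  have "s0 \<noteq> 0"
  proof
    assume "s0 = 0"
    then obtain b where "b > 0" "\<And>r. 0 < r \<Longrightarrow> r < b \<Longrightarrow> s r = 0"
      using e(2) unfolding eventually_at_right_field by auto
    then show False using s_not_locally_zero[of 0 b] by simp
  qed
  then show thesis using e that by blast
qed

lemma s_nonzero_near_0: "\<forall>\<^sub>F r in at_right 0. s r \<noteq> 0"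
proof -
  obtain s0 \<epsilon> where e: "s0 \<noteq> 0" "(\<epsilon> \<longlongrightarrow> 0) (at_right 0)"
    "\<forall>\<^sub>F r in at_right 0. s r = s0 * r ^ n * (1 + \<epsilon> r)"
    by (rule s_near_0)
  have "\<forall>\<^sub>F r in at_right 0. \<epsilon> r > -1"
    using order_tendstoD(1)[OF e(2), of "-1"] by simp
  with e(3) eventually_at_right_less[of "0::real"] show ?thesis
    by eventually_elim (use e(1) in auto)
qed

text \<open>At a zero \<open>T\<close> of \<open>s\<close>, simplicity makes \<open>s\<^sup>2\<close> monotone just to the right of \<open>T\<close>; elsewhere
  continuity suffices.\<close>
lemma s_sq_right_comparison:
  assumes T: "T > 0"
  obtains d where "d > 0" "\<And>q r. T \<le> q \<Longrightarrow> q \<le> r \<Longrightarrow> r \<le> T + d \<Longrightarrow> (s q)\<^sup>2 \<le> 4 * (s r)\<^sup>2"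
    "\<And>r. T < r \<Longrightarrow> r \<le> T + d \<Longrightarrow> s r \<noteq> 0"
proof (cases "s T = 0")
  case False
  have "isCont s T" using DERIV_isCont[OF ds[OF T]] .
  \<comment> \<open>With tolerance one third, \<open>s q\<close> is at most 4/3 and
    \<open>s r\<close> at least 2/3 of \<open>s T\<close> in absolute value. This gives a ratio of
    at most 2, hence the factor 4 for the squares.\<close>
  then obtain d where d: "d > 0" "\<And>r. dist r T < d \<Longrightarrow> dist (s r) (s T) < \<bar>s T\<bar> / 3"
    unfolding continuous_at_eps_delta using False by (metis divide_pos_pos zero_less_abs_iff zero_less_numeral)
  have near: "\<bar>s r - s T\<bar> < \<bar>s T\<bar> / 3" if "T \<le> r" "r \<le> T + d / 2" for r
    using d(2)[of r] that d(1) by (auto simp: dist_real_def)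
  show thesis
  proof
    show "d / 2 > 0" using d(1) by simp
    show "s r \<noteq> 0" if "T < r" "r \<le> T + d / 2" for r using near[of r] that by auto
    fix q r assume qr: "T \<le> q" "q \<le> r" "r \<le> T + d / 2"
    have "\<bar>s q\<bar> \<le> \<bar>2 * s r\<bar>" using near[of q] near[of r] qr by linarith
    then have "(s q)\<^sup>2 \<le> (2 * s r)\<^sup>2" by (simp only: abs_le_square_iff)
    then show "(s q)\<^sup>2 \<le> 4 * (s r)\<^sup>2" by (simp add: power_mult_distrib)
  qed
next
  case True
  \<comment> \<open>Multiplying by the sign of the slope treats upward and downward crossings
    together: \<open>e * s\<close> increases from 0.\<close>
  define e where "e = sgn (deriv s T)"
  have s': "deriv s T \<noteq> 0" using s_zero_simple[OF T True] .
  have "isCont (deriv s) T" using DERIV_isCont[OF ds'[OF T]] .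
  then obtain d where d: "d > 0" "\<And>r. dist r T < d \<Longrightarrow> dist (deriv s r) (deriv s T) < \<bar>deriv s T\<bar>"
    unfolding continuous_at_eps_delta using s' by (metis zero_less_abs_iff)
  have near: "e * deriv s r > 0" if "T \<le> r" "r \<le> T + d / 2" for r
    using d(2)[of r] that d(1) s' by (auto simp: dist_real_def e_def sgn_if split: if_splits)
  have mono: "e * s q < e * s r" if "T \<le> q" "q < r" "r \<le> T + d / 2" for q r
  proof (rule DERIV_pos_imp_increasing[OF that(2)])
    fix t assume t: "q \<le> t" "t \<le> r"
    then have t0: "t > 0" using T that by simp
    have "((\<lambda>t. e * s t) has_real_derivative e * deriv s t) (at t)"
      by (auto intro!: derivative_eq_intros ds[OF t0])
    then show "\<exists>y. ((\<lambda>t. e * s t) has_real_derivative y) (at t) \<and> 0 < y"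
      using near[of t] t that by (intro exI conjI) auto
  qed
  show thesis
  proof
    show "d / 2 > 0" using d(1) by simp
    show "s r \<noteq> 0" if "T < r" "r \<le> T + d / 2" for r using mono[of T r] that True by auto
    fix q r assume qr: "T \<le> q" "q \<le> r" "r \<le> T + d / 2"
    have "0 \<le> e * s q" using mono[of T q] qr True by (cases "q = T") auto
    moreover have "e * s q \<le> e * s r" using mono[of q r] qr by (cases "q = r") auto
    ultimately have "(e * s q)\<^sup>2 \<le> (e * s r)\<^sup>2" by (simp add: power_mono)
    moreover have "e\<^sup>2 = 1" using s' by (simp add: e_def sgn_if)
    ultimately have "(s q)\<^sup>2 \<le> (s r)\<^sup>2" by (simp add: power_mult_distrib)
    then show "(s q)\<^sup>2 \<le> 4 * (s r)\<^sup>2" using zero_le_power2[of "s r"] by linarith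
  qed
qed

end

section \<open>The linearised equations as a first-order system\<close>

locale W_field = vortex +
  fixes \<gamma> :: real and m :: int and u v u' v' v'' :: "real \<Rightarrow> real"
  assumes gamma: "0 < \<gamma>" "\<gamma> \<le> 1"
    and du: "0 < r \<Longrightarrow> (u has_real_derivative u' r) (at r)"
    and dv: "0 < r \<Longrightarrow> (v has_real_derivative v' r) (at r)"
    and dv': "0 < r \<Longrightarrow> (v' has_real_derivative v'' r) (at r)"
    and eq_v: "0 < r \<Longrightarrow> v'' r + v' r / r - v r / r\<^sup>2
      + 2 * (2 * deriv (y_prof \<gamma> n m z) r * u r + y_prof \<gamma> n m z r * u' r
        + y_prof \<gamma> n m z r * u r / r) - \<gamma> * v r * (s r)\<^sup>2 = 0"
    and eq_u: "0 < r \<Longrightarrow> v' r * y_prof \<gamma> n m z r - v r * deriv (y_prof \<gamma> n m z) r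
      + (2 * (y_prof \<gamma> n m z r)\<^sup>2 + \<gamma> / 2 * (s r)\<^sup>2) * u r = 0"
begin

abbreviation "x \<equiv> x_prof \<gamma> n m z"
abbreviation "y \<equiv> y_prof \<gamma> n m z"

text \<open>\<open>B\<close> is the covariant curl of the W field: \<open>v' + v / r\<close> is the
  radial part of the ordinary curl, and \<open>2 y u\<close> collects the angular derivative and the
  coupling to the vortex.\<close>

definition B :: "real \<Rightarrow> real" where "B r = v' r + v r / r + 2 * y r * u r"
definition P :: "real \<Rightarrow> real" where "P r = r * (s r)\<^sup>2 * u r"
definition Q :: "real \<Rightarrow> real" where "Q r = r * v r"

lemma r_times_x: "r > 0 \<Longrightarrow> r * x r = (\<gamma> - 1) * Z r - \<gamma> * n - m / 2"
  and r_times_y: "r > 0 \<Longrightarrow> r * y r = \<gamma> * Z r - \<gamma> * n - m / 2"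
  by (simp_all add: x_prof_def y_prof_def Z_def field_simps)

lemma x_eq: "x r = y r - z r"
  by (simp add: x_prof_def y_prof_def algebra_simps)

lemma dy: assumes r: "r > 0" shows "(y has_real_derivative \<gamma> * h r - y r / r) (at r)"
proof -
  have "((\<lambda>r. \<gamma> * z r - (2 * \<gamma> * n + m) / 2 * inverse r) has_real_derivative
      \<gamma> * deriv z r + (2 * \<gamma> * n + m) / 2 * (inverse r * inverse r)) (at r)"
    using r by (auto intro!: derivative_eq_intros dz simp: power2_eq_square)
  moreover have "(\<lambda>r. \<gamma> * z r - (2 * \<gamma> * n + m) / 2 * inverse r) = y"
    by (simp add: y_prof_def fun_eq_iff field_simps)
  moreover have "\<gamma> * deriv z r + (2 * \<gamma> * n + m) / 2 * (inverse r * inverse r) = \<gamma> * h r - y r / r"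
    using r by (simp add: y_prof_def h_def field_simps)
  ultimately show ?thesis by simp
qed

lemma deriv_y: "r > 0 \<Longrightarrow> deriv y r = \<gamma> * h r - y r / r"
  by (rule DERIV_imp_deriv[OF dy])

text \<open>Inserting \<open>y' = \<gamma> h - y / r\<close> into the equation for \<open>v\<close>
  makes all terms with \<open>v''\<close> and \<open>u'\<close> combine into
  \<open>B'\<close>.\<close>

lemma dB: assumes r: "r > 0"
  shows "(B has_real_derivative \<gamma> * (s r)\<^sup>2 * v r - 2 * \<gamma> * h r * u r) (at r)"
proof -
  have "(B has_real_derivative v'' r + (v' r * r - v r) / (r * r)
      + 2 * ((\<gamma> * h r - y r / r) * u r + y r * u' r)) (at r)"
    unfolding B_def using r
    by (auto intro!: derivative_eq_intros du dv dv' dy simp: algebra_simps)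
  moreover have "v'' r + (v' r * r - v r) / (r * r) + 2 * ((\<gamma> * h r - y r / r) * u r + y r * u' r)
      = \<gamma> * (s r)\<^sup>2 * v r - 2 * \<gamma> * h r * u r"
  proof -
    have "(v' r * r - v r) / (r * r) = v' r / r - v r / r\<^sup>2"
      using r by (simp add: field_simps power2_eq_square)
    then show ?thesis using eq_v[OF r] by (simp add: deriv_y[OF r] algebra_simps)
  qed
  ultimately show ?thesis by simp
qed

lemma B_eq: assumes r: "r > 0"
  shows "y r * B r = \<gamma> * h r * v r - \<gamma> / 2 * (s r)\<^sup>2 * u r"
proof -
  have "y r * B r - (\<gamma> * h r * v r - \<gamma> / 2 * (s r)\<^sup>2 * u r)
    = v' r * y r - v r * (\<gamma> * h r - y r / r) + (2 * (y r)\<^sup>2 + \<gamma> / 2 * (s r)\<^sup>2) * u r"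
    by (simp add: B_def algebra_simps power2_eq_square)
  then show ?thesis using eq_u[OF r] deriv_y[OF r] by simp
qed

lemma dP: assumes r: "r > 0" shows "(P has_real_derivative - 2 * x r * (s r)\<^sup>2 * Q r) (at r)"
proof -
  let ?D = "(\<gamma> * h r - y r / r) * B r + y r * (\<gamma> * (s r)\<^sup>2 * v r - 2 * \<gamma> * h r * u r)
    - \<gamma> * (z r * (s r)\<^sup>2 * v r + h r * v' r)
    + \<gamma> / 2 * (2 * s r * deriv s r * u r + (s r)\<^sup>2 * u' r)"
  let ?P' = "(s r)\<^sup>2 * u r + r * (2 * s r * deriv s r * u r + (s r)\<^sup>2 * u' r)"
  have "((\<lambda>r. y r * B r - \<gamma> * (h r * v r) + \<gamma> / 2 * ((s r)\<^sup>2 * u r)) has_real_derivative ?D) (at r)"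
    by (auto intro!: derivative_eq_intros dy[OF r] dB[OF r] dh[OF r] ds[OF r] du[OF r] dv[OF r]
        simp: algebra_simps)
  moreover have "((\<lambda>r. y r * B r - \<gamma> * (h r * v r) + \<gamma> / 2 * ((s r)\<^sup>2 * u r))
      has_real_derivative 0) (at r)"
    by (rule has_field_derivative_transform_within_open[of "\<lambda>_. 0" _ _ "{0<..}"])
      (use r B_eq in auto)
  ultimately have D: "?D = 0" using DERIV_unique by blast
  \<comment> \<open>Adding the constraint \<open>B_eq\<close> cancels the \<open>y B\<close> term of
    \<open>r * ?D\<close> and supplies the part \<open>s^2 u\<close> of \<open>?P'\<close>. The
    definition of \<open>B\<close> cancels the terms with \<open>h\<close>. The remaining terms in
    \<open>v\<close> carry the factor \<open>y - z = x\<close>.\<close>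
  have "\<gamma> / 2 * (?P' + 2 * x r * (s r)\<^sup>2 * Q r)
    = r * ?D + (y r * B r - (\<gamma> * h r * v r - \<gamma> / 2 * (s r)\<^sup>2 * u r))
      + \<gamma> * h r * (r * v' r + v r + 2 * r * y r * u r - r * B r)"
    using r by (simp add: x_eq Q_def field_simps)
  also have "\<dots> = 0"
    using r D B_eq[OF r] by (simp add: B_def algebra_simps)
  finally have "?P' = - 2 * x r * (s r)\<^sup>2 * Q r"
    using gamma by simp
  moreover have "(P has_real_derivative ?P') (at r)"
    unfolding P_def
    by (auto intro!: derivative_eq_intros ds[OF r] du[OF r] simp: algebra_simps)
  ultimately show ?thesis by simp
qed

text \<open>In \<open>Q' = r (B - 2 y u)\<close> the field \<open>B\<close> is eliminated by
  dividing \<open>B_eq\<close> by \<open>y\<close>. The product \<open>r u\<close> is kept because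
  \<open>P\<close> determines \<open>u\<close> only where \<open>s\<close> is nonzero.\<close>

lemma dQ: assumes r: "r > 0" and y: "y r \<noteq> 0"
  shows "(Q has_real_derivative
    \<gamma> * h r / y r * Q r - y r * (\<gamma> * (s r)\<^sup>2 / (2 * (y r)\<^sup>2) + 2) * (r * u r)) (at r)"
proof -
  have "(Q has_real_derivative v r + r * v' r) (at r)"
    unfolding Q_def by (auto intro!: derivative_eq_intros dv[OF r])
  moreover have "v r + r * v' r = r * B r - 2 * y r * (r * u r)"
    using r by (simp add: B_def algebra_simps)
  moreover have "B r = (\<gamma> * h r * v r - \<gamma> / 2 * (s r)\<^sup>2 * u r) / y r"
    using B_eq[OF r] y by (simp add: field_simps)
  moreover have "r * ((\<gamma> * h r * v r - \<gamma> / 2 * (s r)\<^sup>2 * u r) / y r) - 2 * y r * (r * u r)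
    = \<gamma> * h r / y r * Q r - y r * (\<gamma> * (s r)\<^sup>2 / (2 * (y r)\<^sup>2) + 2) * (r * u r)"
    using y by (simp add: Q_def field_simps power2_eq_square)
  ultimately show ?thesis by simp
qed

text \<open>When \<open>x\<close> and \<open>y\<close> have the common sign \<open>- e\<close>, the first-order system for \<open>(e P, Q)\<close> is
  cooperative (nonnegative off-diagonal coefficients), so the positive quadrant is invariant.\<close>
lemma cone_growth:
  assumes e: "e = 1 \<or> e = (-1::real)"
    and x: "\<And>r. 0 < r \<Longrightarrow> e * x r < 0" and y: "\<And>r. 0 < r \<Longrightarrow> e * y r < 0"
    and b: "0 < b" "\<And>r. 0 < r \<Longrightarrow> r < b \<Longrightarrow> v r > 0" "\<And>r. 0 < r \<Longrightarrow> r < b \<Longrightarrow> s r \<noteq> 0"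
    and P0: "(P \<longlongrightarrow> 0) (at_right 0)"
  shows "\<exists>a>0. e * P a > 0 \<and> (\<forall>r\<ge>a. e * P r \<ge> e * P a)"
proof -
  define a where "a = b / 2"
  have a: "0 < a" "a < b" using b(1) by (auto simp: a_def)
  have deP: "((\<lambda>r. e * P r) has_real_derivative (- (e * x r)) * (2 * (s r)\<^sup>2 * (r * v r))) (at r)"
    if "r > 0" for r
    by (rule DERIV_cong[OF DERIV_cmult[OF dP[OF that]]]) (simp add: Q_def)
  have Pa: "e * P a > 0"
  proof (rule increasing_from_zero[OF _ deP])
    show "((\<lambda>r. e * P r) \<longlongrightarrow> 0) (at_right 0)" using tendsto_mult_left[OF P0, of e] by simp
    show "0 < - (e * x r) * (2 * (s r)\<^sup>2 * (r * v r))" if "0 < r" "r < b" for r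
      using x[OF that(1)] b(2)[OF that] b(3)[OF that] that
      by (intro mult_pos_pos) auto
  qed (use a in auto)
  have mono: "e * P a \<le> e * P t" if t: "a \<le> t" "\<And>r. a \<le> r \<Longrightarrow> r \<le> t \<Longrightarrow> v r \<ge> 0" for t
  proof (rule DERIV_nonneg_imp_nondecreasing[OF t(1)])
    fix r assume r: "a \<le> r" "r \<le> t"
    then have "r > 0" using a by simp
    moreover have "0 \<le> - (e * x r) * (2 * (s r)\<^sup>2 * (r * v r))"
      using x[OF \<open>r > 0\<close>] t(2)[OF r] \<open>r > 0\<close> by (intro mult_nonneg_nonneg) auto
    ultimately show "\<exists>q. ((\<lambda>r. e * P r) has_real_derivative q) (at r) \<and> 0 \<le> q"
      using deP by blast
  qed
  \<comment> \<open>Up to a first zero \<open>t\<close> of \<open>v\<close> the quantity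
    \<open>e * P\<close> does not decrease. With \<open>K\<close> bounding the diagonal coefficient
    in \<open>dQ\<close>, \<open>Q r * exp (K * r)\<close> does not decrease either, so
    \<open>Q t > 0\<close>, contrary to \<open>v t = 0\<close>.\<close>
  have "v c > 0" if c: "a \<le> c" for c
  proof (rule ccontr)
    assume "\<not> v c > 0"
    moreover have "continuous_on {a..c} v" by (rule DERIV_continuous_on_Icc[OF a(1) dv])
    ultimately obtain t where t: "a < t" "v t = 0" "\<And>r. a \<le> r \<Longrightarrow> r < t \<Longrightarrow> v r > 0"
      using first_zero[of a c v] c b(2)[OF a] by (metis linorder_not_less)
    have vt: "v r \<ge> 0" if "a \<le> r" "r \<le> t" for r
      using t(2,3) that by (cases "r = t") (auto intro: less_imp_le)
    have y0: "y r \<noteq> 0" if "r > 0" for r using y[OF that] by auto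
    have "continuous_on {a..t} (\<lambda>r. \<gamma> * h r / y r)"
      using y0 a by (intro continuous_intros continuous_on_field DERIV_continuous_on_Icc[OF a(1) dy])
        auto
    then obtain K where K: "\<And>r. a \<le> r \<Longrightarrow> r \<le> t \<Longrightarrow> \<bar>\<gamma> * h r / y r\<bar> \<le> K"
      using continuous_on_Icc_bounded by blast
    have "Q a * exp (K * a) \<le> Q t * exp (K * t)"
    proof (rule DERIV_nonneg_imp_nondecreasing[of a t "\<lambda>r. Q r * exp (K * r)"])
      fix r assume r: "a \<le> r" "r \<le> t"
      have r0: "r > 0" using r a by simp
      have yr: "y r \<noteq> 0" using y[OF r0] by auto
      let ?G = "y r * (\<gamma> * (s r)\<^sup>2 / (2 * (y r)\<^sup>2) + 2) * (r * u r)"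
      have d: "((\<lambda>r. Q r * exp (K * r)) has_real_derivative
          ((\<gamma> * h r / y r + K) * Q r - ?G) * exp (K * r)) (at r)"
        by (rule DERIV_cong[OF DERIV_mult[OF dQ[OF r0 yr] DERIV_chain2[OF DERIV_exp DERIV_cmult_Id]]])
          (simp add: algebra_simps)
      \<comment> \<open>Positivity of \<open>e * P\<close> also excludes zeros of \<open>s\<close>,
        so the sign of \<open>u\<close> can be read off from it.\<close>
      have "e * P r > 0" using mono[of r] Pa r vt by fastforce
      then have "(r * (s r)\<^sup>2) * (e * u r) > 0" by (simp add: P_def mult_ac)
      moreover have "r * (s r)\<^sup>2 \<ge> 0" using r0 by simp
      ultimately have "e * u r \<ge> 0"
        by (meson less_imp_le linorder_not_less mult_nonneg_nonpos)
      have "0 \<le> \<gamma> * (s r)\<^sup>2 / (2 * (y r)\<^sup>2) + 2" using gamma by simp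
      then have "0 \<le> (- (e * y r)) * (\<gamma> * (s r)\<^sup>2 / (2 * (y r)\<^sup>2) + 2) * (r * (e * u r))"
        using y[OF r0] r0 \<open>e * u r \<ge> 0\<close>
        by (intro mult_nonneg_nonneg[OF mult_nonneg_nonneg mult_nonneg_nonneg]) auto
      also have "\<dots> = - ((e * e) * ?G)" by (simp add: algebra_simps)
      also have "e * e = 1" using e by auto
      finally have "?G \<le> 0" by simp
      have "0 \<le> \<gamma> * h r / y r + K"
        using K[OF r] unfolding abs_le_iff by linarith
      then have Q_term: "0 \<le> (\<gamma> * h r / y r + K) * Q r"
        using vt[OF r] r0 by (intro mult_nonneg_nonneg) (simp_all add: Q_def)
      have "0 \<le> ((\<gamma> * h r / y r + K) * Q r - ?G) * exp (K * r)"
        using Q_term \<open>?G \<le> 0\<close> by (intro mult_nonneg_nonneg) auto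
      with d show "\<exists>q. ((\<lambda>r. Q r * exp (K * r)) has_real_derivative q) (at r) \<and> 0 \<le> q" by blast
    qed (use t in simp)
    then show False using t(2) a b(2)[OF a] by (simp add: Q_def mult_le_0_iff)
  qed
  then have "\<forall>r\<ge>a. e * P r \<ge> e * P a" by (auto intro!: mono intro: less_imp_le)
  then show ?thesis using a Pa by blast
qed

text \<open>The equations for \<open>B\<close>, \<open>v\<close> and \<open>P\<close> degenerate at zeros of \<open>s\<close>, where \<open>u\<close> cannot be recovered
  continuously from \<open>P\<close>; the comparison of values of \<open>s\<^sup>2\<close> replaces the missing lower bound.\<close>
lemma local_uniqueness:
  assumes T: "T > 0" and zero: "\<And>r. 0 < r \<Longrightarrow> r < T \<Longrightarrow> u r = 0 \<and> v r = 0"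
  shows "\<exists>d>0. \<forall>r. 0 < r \<and> r < T + d \<longrightarrow> u r = 0 \<and> v r = 0"
proof -
  have lim: "f T = 0" if "isCont f T" "\<And>r. 0 < r \<Longrightarrow> r < T \<Longrightarrow> f r = 0" for f :: "real \<Rightarrow> real"
  proof -
    have "(f \<longlongrightarrow> f T) (at_left T)"
      using that(1) unfolding isCont_def by (rule filterlim_mono) (auto simp: at_le)
    moreover have "\<forall>\<^sub>F r in at_left T. f r = 0"
      using eventually_at_left_real[OF T] by eventually_elim (use that(2) in auto)
    then have "(f \<longlongrightarrow> 0) (at_left T)" by (rule tendsto_eventually)
    ultimately show ?thesis using tendsto_unique[of "at_left T" f "f T" 0] by simp
  qed
  have uT: "u T = 0" by (rule lim[OF DERIV_isCont[OF du[OF T]]]) (use zero in auto)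
  have vT: "v T = 0" by (rule lim[OF DERIV_isCont[OF dv[OF T]]]) (use zero in auto)
  have "B r = 0" if r: "0 < r" "r < T" for r
  proof -
    have "(v has_real_derivative 0) (at r)"
      by (rule has_field_derivative_transform_within_open[of "\<lambda>_. 0" _ _ "{0<..<T}"])
        (use zero r in auto)
    then have "v' r = 0" using DERIV_unique dv[OF r(1)] by blast
    then show ?thesis using zero[OF r] by (simp add: B_def)
  qed
  then have BT: "B T = 0" by (rule lim[OF DERIV_isCont[OF dB[OF T]]])
  obtain d where d: "d > 0"
    "\<And>q r. T \<le> q \<Longrightarrow> q \<le> r \<Longrightarrow> r \<le> T + d \<Longrightarrow> (s q)\<^sup>2 \<le> 4 * (s r)\<^sup>2"
    "\<And>r. T < r \<Longrightarrow> r \<le> T + d \<Longrightarrow> s r \<noteq> 0"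
    using s_sq_right_comparison[OF T] by blast
  have cy: "continuous_on {T..T + d} y" by (rule DERIV_continuous_on_Icc[OF T dy])
  have cx: "continuous_on {T..T + d} x"
    unfolding x_eq[abs_def] by (intro continuous_intros cy continuous_on_field T)
  \<comment> \<open>One constant is to bound every coefficient of the system; the summand 1 accounts
    for the coefficient of \<open>B\<close> in \<open>v'\<close>.\<close>
  have "continuous_on {T..T + d}
      (\<lambda>r. \<bar>\<gamma> * (s r)\<^sup>2\<bar> + \<bar>2 * \<gamma> * h r\<bar> + \<bar>1 / r\<bar> + \<bar>2 * y r\<bar> + \<bar>2 * x r\<bar> + 1)"
    using T by (intro continuous_intros continuous_on_field cx cy) auto
  then obtain K where "K \<ge> 0" and K: "\<And>r. T \<le> r \<Longrightarrow> r \<le> T + d \<Longrightarrow>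
      \<bar>\<bar>\<gamma> * (s r)\<^sup>2\<bar> + \<bar>2 * \<gamma> * h r\<bar> + \<bar>1 / r\<bar> + \<bar>2 * y r\<bar> + \<bar>2 * x r\<bar> + 1\<bar> \<le> K"
    using continuous_on_Icc_bounded by blast
  have coeff: "\<bar>\<gamma> * (s r)\<^sup>2\<bar> \<le> K" "\<bar>2 * \<gamma> * h r\<bar> \<le> K" "\<bar>1 / r\<bar> \<le> K" "\<bar>2 * y r\<bar> \<le> K"
    "\<bar>2 * x r\<bar> \<le> K" "1 \<le> K" if "T \<le> r" "r \<le> T + d" for r
  proof -
    have "a1 \<le> K \<and> a2 \<le> K \<and> a3 \<le> K \<and> a4 \<le> K \<and> a5 \<le> K \<and> 1 \<le> K"
      if "a1 + a2 + a3 + a4 + a5 + 1 \<le> K" "0 \<le> a1" "0 \<le> a2" "0 \<le> a3" "0 \<le> a4" "0 \<le> a5"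
      for a1 a2 a3 a4 a5
      using that by linarith
    from this[OF order_trans[OF abs_ge_self K[OF that]] abs_ge_zero abs_ge_zero abs_ge_zero
        abs_ge_zero abs_ge_zero]
    show "\<bar>\<gamma> * (s r)\<^sup>2\<bar> \<le> K" "\<bar>2 * \<gamma> * h r\<bar> \<le> K" "\<bar>1 / r\<bar> \<le> K" "\<bar>2 * y r\<bar> \<le> K"
      "\<bar>2 * x r\<bar> \<le> K" "1 \<le> K" by blast+
  qed
  have K1: "K \<ge> 1" using coeff(6)[of T] d(1) by simp
  \<comment> \<open>The estimates below bound \<open>B\<close>, \<open>v\<close> and
    \<open>u\<close> at \<open>t\<close> by \<open>(t - T) * K * w t\<close> times 2, 3 and 4. The
    sum 9 and this choice of \<delta> give \<open>w t\<close> at most half of itself.\<close>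
  define \<delta> where "\<delta> = min d (1 / (18 * K))"
  have \<delta>: "\<delta> > 0" "\<delta> \<le> d" "\<delta> * (9 * K) \<le> 1 / 2"
  proof -
    have "\<delta> \<le> 1 / (18 * K)" by (simp add: \<delta>_def)
    then have "\<delta> * (9 * K) \<le> 1 / (18 * K) * (9 * K)"
      using K1 by (intro mult_right_mono) auto
    then show "\<delta> * (9 * K) \<le> 1 / 2" using K1 by simp
  qed (use d(1) K1 in \<open>auto simp: \<delta>_def\<close>)
  \<comment> \<open>The estimates are made at a maximum point \<open>t\<close> of \<open>w\<close>,
    where \<open>w t\<close> dominates the fields at all earlier points.\<close>
  define w where "w r = \<bar>B r\<bar> + \<bar>v r\<bar> + \<bar>u r\<bar>" for r
  have "continuous_on {T..T + \<delta>} w"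
    unfolding w_def
    by (intro continuous_intros DERIV_continuous_on_Icc[OF T dB] DERIV_continuous_on_Icc[OF T dv]
        DERIV_continuous_on_Icc[OF T du])
  then obtain t where t: "T \<le> t" "t \<le> T + \<delta>"
    and max: "\<And>q. T \<le> q \<Longrightarrow> q \<le> T + \<delta> \<Longrightarrow> w q \<le> w t"
    using continuous_attains_sup[of "{T..T + \<delta>}" w] \<delta>(1) by auto
  have wt0: "w t \<ge> 0" by (simp add: w_def)
  have "w t \<le> 0"
  proof (cases "t = T")
    case True
    then show ?thesis by (simp add: w_def uT vT BT)
  next
    case False
    then have Tt: "T < t" using t by simp
    have mvt: "\<bar>f t\<bar> \<le> (t - T) * C"
      if f0: "f T = 0" and fd: "\<And>q. q > 0 \<Longrightarrow> (f has_real_derivative f' q) (at q)"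
        and fb: "\<And>q. T \<le> q \<Longrightarrow> q \<le> t \<Longrightarrow> \<bar>f' q\<bar> \<le> C" for f f' :: "real \<Rightarrow> real" and C
    proof -
      obtain q where q: "T < q" "q < t" "f t - f T = (t - T) * f' q"
        using MVT2[OF Tt, of f f'] fd T by force
      then have "\<bar>f t\<bar> = (t - T) * \<bar>f' q\<bar>" using f0 Tt by (simp add: abs_mult)
      then show ?thesis using fb[of q] q Tt by (simp add: mult_left_mono)
    qed
    have prod_le: "\<bar>a * f\<bar> \<le> K * w t" if "\<bar>a\<bar> \<le> K" "\<bar>f\<bar> \<le> w t" for a f
      unfolding abs_mult using that K1 by (intro mult_mono) auto
    have wq: "\<bar>B q\<bar> \<le> w t" "\<bar>v q\<bar> \<le> w t" "\<bar>u q\<bar> \<le> w t" if "T \<le> q" "q \<le> t" for q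
      using max[of q] that t unfolding w_def by linarith+
    have "\<bar>B t\<bar> \<le> (t - T) * (K * w t + K * w t)"
    proof (rule mvt[OF BT dB])
      fix q assume q: "T \<le> q" "q \<le> t"
      then have q': "T \<le> q" "q \<le> T + d" using t \<delta> by auto
      show "\<bar>\<gamma> * (s q)\<^sup>2 * v q - 2 * \<gamma> * h q * u q\<bar> \<le> K * w t + K * w t"
        using prod_le[OF coeff(1)[OF q'] wq(2)[OF q]] prod_le[OF coeff(2)[OF q'] wq(3)[OF q]]
        by linarith
    qed
    moreover have "\<bar>v t\<bar> \<le> (t - T) * (K * w t + K * w t + K * w t)"
    proof (rule mvt[OF vT dv])
      fix q assume q: "T \<le> q" "q \<le> t"
      then have q': "T \<le> q" "q \<le> T + d" using t \<delta> by auto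
      have "v' q = 1 * B q - 1 / q * v q - 2 * y q * u q" by (simp add: B_def)
      moreover have "\<bar>1 * B q\<bar> \<le> K * w t" using K1 by (intro prod_le wq q) auto
      ultimately show "\<bar>v' q\<bar> \<le> K * w t + K * w t + K * w t"
        using prod_le[OF coeff(3)[OF q'] wq(2)[OF q]] prod_le[OF coeff(4)[OF q'] wq(3)[OF q]] by linarith
    qed
    moreover have "\<bar>u t\<bar> \<le> (t - T) * (4 * (K * w t))"
    proof -
      \<comment> \<open>The derivative of \<open>P\<close> at \<open>q\<close> carries
        \<open>(s q)^2\<close>, which is at most \<open>4 * (s t)^2\<close>. The factor
        \<open>(s t)^2\<close> is positive since \<open>t > T\<close>, and cancels against the one
        in \<open>P t\<close>.\<close>
      have "\<bar>P t\<bar> \<le> (t - T) * (4 * (s t)\<^sup>2 * t * (K * w t))"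
      proof (rule mvt[OF _ dP])
        show "P T = 0" by (simp add: P_def uT)
        fix q assume q: "T \<le> q" "q \<le> t"
        then have q': "T \<le> q" "q \<le> T + d" using t \<delta> by auto
        have "\<bar>- 2 * x q * (s q)\<^sup>2 * Q q\<bar> = (s q)\<^sup>2 * (q * \<bar>2 * x q * v q\<bar>)"
          using q T by (simp add: Q_def abs_mult)
        also have "\<dots> \<le> (4 * (s t)\<^sup>2) * (t * (K * w t))"
          using q T t \<delta> by (intro mult_mono d(2) prod_le coeff(5)[OF q'] wq(2)[OF q]) auto
        finally show "\<bar>- 2 * x q * (s q)\<^sup>2 * Q q\<bar> \<le> 4 * (s t)\<^sup>2 * t * (K * w t)" by simp
      qed
      moreover have st: "(s t)\<^sup>2 * t > 0" using d(3)[of t] Tt t \<delta> T by simp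
      moreover have "\<bar>P t\<bar> = ((s t)\<^sup>2 * t) * \<bar>u t\<bar>" using T Tt by (simp add: P_def abs_mult)
      moreover have "(t - T) * (4 * (s t)\<^sup>2 * t * (K * w t))
          = ((s t)\<^sup>2 * t) * ((t - T) * (4 * (K * w t)))"
        by (simp add: algebra_simps)
      ultimately have "((s t)\<^sup>2 * t) * \<bar>u t\<bar> \<le> ((s t)\<^sup>2 * t) * ((t - T) * (4 * (K * w t)))"
        by linarith
      then show ?thesis using st by (simp only: mult_le_cancel_left_pos)
    qed
    ultimately have "w t \<le> ((t - T) * (9 * K)) * w t" unfolding w_def[of t] by (simp add: algebra_simps)
    also have "\<dots> \<le> (\<delta> * (9 * K)) * w t"
      using t wt0 K1 by (intro mult_right_mono) auto
    also have "\<dots> \<le> (1 / 2) * w t" by (rule mult_right_mono[OF \<delta>(3) wt0])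
    finally show ?thesis by simp
  qed
  then have "u q = 0 \<and> v q = 0" if "T \<le> q" "q \<le> T + \<delta>" for q
    using max[OF that] unfolding w_def[of q] by linarith
  then have "\<forall>r. 0 < r \<and> r < T + \<delta> \<longrightarrow> u r = 0 \<and> v r = 0"
    using zero by (meson less_imp_le linorder_not_less)
  then show ?thesis using \<delta>(1) by blast
qed

text \<open>At the supremum \<open>T\<close> of all radii up to which both fields vanish,
  \<open>local_uniqueness\<close> would extend the vanishing beyond \<open>T\<close>.\<close>

lemma uniqueness:
  assumes "b > 0" and zero: "\<And>r. 0 < r \<Longrightarrow> r < b \<Longrightarrow> u r = 0 \<and> v r = 0" and c: "c > 0"
  shows "u c = 0 \<and> v c = 0"
proof (rule ccontr)
  assume nz: "\<not> ?thesis"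
  define S where "S = {t. \<forall>r. 0 < r \<and> r < t \<longrightarrow> u r = 0 \<and> v r = 0}"
  have bdd: "t \<le> c" if "t \<in> S" for t
    using nz c that unfolding S_def by (metis (mono_tags, lifting) linorder_not_less mem_Collect_eq)
  then have "bdd_above S" by (auto simp: bdd_above_def)
  have "b \<in> S" using zero by (simp add: S_def)
  define T where "T = Sup S"
  have "b \<le> T" unfolding T_def by (rule cSup_upper) fact+
  then have "T > 0" using \<open>b > 0\<close> by simp
  moreover have "u r = 0 \<and> v r = 0" if r: "0 < r" "r < T" for r
  proof -
    obtain t where "t \<in> S" "r < t"
      using r(2) less_cSup_iff[of S r] \<open>b \<in> S\<close> \<open>bdd_above S\<close> unfolding T_def by blast
    then show ?thesis using r(1) by (simp add: S_def)
  qed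
  ultimately obtain d where "d > 0" "T + d \<in> S"
    using local_uniqueness[of T] unfolding S_def by blast
  then have "T + d \<le> T" using cSup_upper[of "T + d" S] \<open>bdd_above S\<close> by (simp add: T_def)
  then show False using \<open>d > 0\<close> by simp
qed

end

section \<open>Asymptotics at the origin and the case distinction on \<open>m\<close>\<close>

lemma powr_law_pos:
  fixes f \<epsilon> :: "real \<Rightarrow> real"
  assumes "f0 > 0" and "(\<epsilon> \<longlongrightarrow> 0) (at_right 0)"
    and "\<forall>\<^sub>F r in at_right 0. f r = f0 * r powr k * (1 + \<epsilon> r)"
  shows "\<forall>\<^sub>F r in at_right 0. f r > 0"
  using assms(3) order_tendstoD(1)[OF assms(2), of "-1", simplified] eventually_at_right_less[of "0::real"]
proof eventually_elim
  case (elim r)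
  then show ?case using assms(1) by simp
qed

lemma powr_law_times_r_tendsto_0:
  fixes f \<epsilon> :: "real \<Rightarrow> real"
  assumes "k > -1" and "(\<epsilon> \<longlongrightarrow> 0) (at_right 0)"
    and "\<forall>\<^sub>F r in at_right 0. f r = f0 * r powr k * (1 + \<epsilon> r)"
  shows "((\<lambda>r. r * f r) \<longlongrightarrow> 0) (at_right 0)"
proof -
  have "((\<lambda>r::real. r powr (k + 1)) \<longlongrightarrow> 0) (at_right 0)"
    using assms(1) by real_asymp
  then have "((\<lambda>r. f0 * r powr (k + 1) * (1 + \<epsilon> r)) \<longlongrightarrow> f0 * 0 * (1 + 0)) (at_right 0)"
    by (intro tendsto_intros assms(2))
  then have "((\<lambda>r. f0 * r powr (k + 1) * (1 + \<epsilon> r)) \<longlongrightarrow> 0) (at_right 0)" by simp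
  then show ?thesis
  proof (rule Lim_transform_eventually)
    show "\<forall>\<^sub>F r in at_right 0. f0 * r powr (k + 1) * (1 + \<epsilon> r) = r * f r"
      using assms(3) eventually_at_right_less[of "0::real"]
      by eventually_elim (simp add: powr_add)
  qed
qed

context W_field
begin

lemma r_times_x_at_0: "((\<lambda>r. r * x r) \<longlongrightarrow> - n - m / 2) (at_right 0)"
  and r_times_y_at_0: "((\<lambda>r. r * y r) \<longlongrightarrow> - m / 2) (at_right 0)"
proof -
  have "((\<lambda>r. (\<gamma> - 1) * Z r - \<gamma> * n - m / 2) \<longlongrightarrow> (\<gamma> - 1) * n - \<gamma> * n - m / 2) (at_right 0)"
    "((\<lambda>r. \<gamma> * Z r - \<gamma> * n - m / 2) \<longlongrightarrow> \<gamma> * n - \<gamma> * n - m / 2) (at_right 0)"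
    by (intro tendsto_intros Z_at_0)+
  then have "((\<lambda>r. (\<gamma> - 1) * Z r - \<gamma> * n - m / 2) \<longlongrightarrow> - n - m / 2) (at_right 0)"
    "((\<lambda>r. \<gamma> * Z r - \<gamma> * n - m / 2) \<longlongrightarrow> - m / 2) (at_right 0)"
    by (simp_all add: algebra_simps)
  then show "((\<lambda>r. r * x r) \<longlongrightarrow> - n - m / 2) (at_right 0)"
    "((\<lambda>r. r * y r) \<longlongrightarrow> - m / 2) (at_right 0)"
    using eventually_at_right_less[of "0::real"]
    by (auto elim!: Lim_transform_eventually eventually_mono simp: r_times_x r_times_y)
qed

text \<open>For \<open>m = - 2 n\<close> the exponents of \<open>P\<close> and of its derivative \<open>- 2 x s\<^sup>2 Q\<close> do not match, because
  \<open>r x\<close> tends to \<open>0\<close>.\<close>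
lemma leading_coefficient_zero:
  assumes m: "m = - 2 * int n" and k: "k > -1"
    and eps: "(\<epsilon>u \<longlongrightarrow> 0) (at_right 0)" "(\<epsilon>v \<longlongrightarrow> 0) (at_right 0)"
    and asym: "\<forall>\<^sub>F r in at_right 0. u r = u0 * r powr k * (1 + \<epsilon>u r)"
      "\<forall>\<^sub>F r in at_right 0. v r = v0 * r powr k * (1 + \<epsilon>v r)"
    and P0: "(P \<longlongrightarrow> 0) (at_right 0)"
  shows "u0 = 0"
proof -
  obtain s0 \<epsilon> where s: "s0 \<noteq> 0" "(\<epsilon> \<longlongrightarrow> 0) (at_right 0)"
    "\<forall>\<^sub>F r in at_right 0. s r = s0 * r ^ n * (1 + \<epsilon> r)"
    using s_near_0 by blast
  \<comment> \<open>This is the exponent of \<open>P = r s^2 u\<close> at the origin. The limit of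
    \<open>P r / r powr \<alpha>\<close> is computed twice: l'Hopital's rule gives 0 because
    \<open>r x\<close> tends to 0, and the asymptotic laws give \<open>s0^2 * u0\<close>.\<close>
  define \<alpha> where "\<alpha> = 2 * n + k + 1"
  have \<alpha>: "\<alpha> > 0" using k by (simp add: \<alpha>_def)
  have pow: "(r ^ n)\<^sup>2 * r powr k = r powr (\<alpha> - 1)" if "r > 0" for r
  proof -
    have "(r ^ n)\<^sup>2 = r powr (2 * n)"
      using that by (simp add: powr_realpow[symmetric] power2_eq_square powr_add[symmetric])
    then show ?thesis by (simp add: \<alpha>_def powr_add[symmetric])
  qed
  have "((\<lambda>r. P r / r powr \<alpha>) \<longlongrightarrow> 0) (at_right 0)"
  proof (rule lhopital_right_0[OF P0])
    show "((\<lambda>r. r powr \<alpha>) \<longlongrightarrow> 0) (at_right 0)" using \<alpha> by real_asymp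
    show "\<forall>\<^sub>F r in at_right 0. r powr \<alpha> \<noteq> 0" "\<forall>\<^sub>F r in at_right 0. \<alpha> * r powr (\<alpha> - 1) \<noteq> 0"
      "\<forall>\<^sub>F r in at_right 0. ((\<lambda>r. r powr \<alpha>) has_real_derivative \<alpha> * r powr (\<alpha> - 1)) (at r)"
      using eventually_at_right_less[of "0::real"] \<alpha>
      by (auto elim!: eventually_mono intro: has_real_derivative_powr)
    show "\<forall>\<^sub>F r in at_right 0. (P has_real_derivative - 2 * x r * (s r)\<^sup>2 * Q r) (at r)"
      using eventually_at_right_less[of "0::real"] by eventually_elim (rule dP)
    have "((\<lambda>r. r * x r) \<longlongrightarrow> 0) (at_right 0)" using r_times_x_at_0 by (simp add: m)
    then have "((\<lambda>r. - 2 / \<alpha> * (r * x r) * (s0 * (1 + \<epsilon> r))\<^sup>2 * (v0 * (1 + \<epsilon>v r)))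
        \<longlongrightarrow> - 2 / \<alpha> * 0 * (s0 * (1 + 0))\<^sup>2 * (v0 * (1 + 0))) (at_right 0)"
      by (intro tendsto_intros s(2) eps)
    then have "((\<lambda>r. - 2 / \<alpha> * (r * x r) * (s0 * (1 + \<epsilon> r))\<^sup>2 * (v0 * (1 + \<epsilon>v r)))
        \<longlongrightarrow> 0) (at_right 0)" by simp
    then show "((\<lambda>r. - 2 * x r * (s r)\<^sup>2 * Q r / (\<alpha> * r powr (\<alpha> - 1))) \<longlongrightarrow> 0) (at_right 0)"
    proof (rule Lim_transform_eventually)
      show "\<forall>\<^sub>F r in at_right 0. - 2 / \<alpha> * (r * x r) * (s0 * (1 + \<epsilon> r))\<^sup>2 * (v0 * (1 + \<epsilon>v r))
          = - 2 * x r * (s r)\<^sup>2 * Q r / (\<alpha> * r powr (\<alpha> - 1))"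
        using s(3) asym(2) eventually_at_right_less[of "0::real"]
      proof eventually_elim
        case (elim r)
        have "- 2 * x r * (s r)\<^sup>2 * Q r
          = - 2 * (r * x r) * (s0 * (1 + \<epsilon> r))\<^sup>2 * (v0 * (1 + \<epsilon>v r)) * ((r ^ n)\<^sup>2 * r powr k)"
          by (simp add: Q_def elim(1,2) power_mult_distrib)
        also have "\<dots> / (\<alpha> * r powr (\<alpha> - 1))
          = - 2 / \<alpha> * (r * x r) * (s0 * (1 + \<epsilon> r))\<^sup>2 * (v0 * (1 + \<epsilon>v r))"
          unfolding pow[OF elim(3)] using elim(3) \<alpha> by simp
        finally show ?case by simp
      qed
    qed
  qed
  moreover have "((\<lambda>r. P r / r powr \<alpha>) \<longlongrightarrow> (s0 * (1 + 0))\<^sup>2 * (u0 * (1 + 0))) (at_right 0)"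
  proof (rule Lim_transform_eventually)
    show "((\<lambda>r. (s0 * (1 + \<epsilon> r))\<^sup>2 * (u0 * (1 + \<epsilon>u r)))
        \<longlongrightarrow> (s0 * (1 + 0))\<^sup>2 * (u0 * (1 + 0))) (at_right 0)"
      by (intro tendsto_intros s(2) eps)
    show "\<forall>\<^sub>F r in at_right 0. (s0 * (1 + \<epsilon> r))\<^sup>2 * (u0 * (1 + \<epsilon>u r)) = P r / r powr \<alpha>"
      using s(3) asym(1) eventually_at_right_less[of "0::real"]
    proof eventually_elim
      case (elim r)
      have "P r = (s0 * (1 + \<epsilon> r))\<^sup>2 * (u0 * (1 + \<epsilon>u r)) * (r * ((r ^ n)\<^sup>2 * r powr k))"
        by (simp add: P_def elim(1,2) power_mult_distrib)
      also have "r * ((r ^ n)\<^sup>2 * r powr k) = r powr \<alpha>"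
        unfolding pow[OF elim(3)] using elim(3) by (simp add: powr_mult_base)
      finally show ?case using elim(3) by simp
    qed
  qed
  ultimately have "(s0 * (1 + 0))\<^sup>2 * (u0 * (1 + 0)) = 0"
    using tendsto_unique[OF trivial_limit_at_right_real] by blast
  then show ?thesis using s(1) by simp
qed

lemma no_solution_with_positive_v0:
  assumes k: "k > - 1 / 2"
    and eps: "(\<epsilon>u \<longlongrightarrow> 0) (at_right 0)" "(\<epsilon>v \<longlongrightarrow> 0) (at_right 0)"
    and asym: "\<forall>\<^sub>F r in at_right 0. u r = u0 * r powr k * (1 + \<epsilon>u r)"
      "\<forall>\<^sub>F r in at_right 0. v r = v0 * r powr k * (1 + \<epsilon>v r)"
    and v0: "v0 > 0" and P_top: "(P \<longlongrightarrow> 0) at_top"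
  shows False
proof -
  have k1: "k > -1" using k by simp
  have Q0: "(Q \<longlongrightarrow> 0) (at_right 0)"
    unfolding Q_def by (rule powr_law_times_r_tendsto_0[OF k1 eps(2) asym(2)])
  obtain s0 \<epsilon> where s: "s0 \<noteq> 0" "(\<epsilon> \<longlongrightarrow> 0) (at_right 0)"
    "\<forall>\<^sub>F r in at_right 0. s r = s0 * r ^ n * (1 + \<epsilon> r)"
    using s_near_0 by blast
  have P0: "(P \<longlongrightarrow> 0) (at_right 0)"
  proof -
    have "((\<lambda>r. (s0 * r ^ n * (1 + \<epsilon> r))\<^sup>2 * (r * u r)) \<longlongrightarrow> (s0 * 0 ^ n * (1 + 0))\<^sup>2 * 0) (at_right 0)"
      by (intro tendsto_intros s(2) powr_law_times_r_tendsto_0[OF k1 eps(1) asym(1)])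
    then have "((\<lambda>r. (s0 * r ^ n * (1 + \<epsilon> r))\<^sup>2 * (r * u r)) \<longlongrightarrow> 0) (at_right 0)" by simp
    then show ?thesis
    proof (rule Lim_transform_eventually)
      show "\<forall>\<^sub>F r in at_right 0. (s0 * r ^ n * (1 + \<epsilon> r))\<^sup>2 * (r * u r) = P r"
        using s(3) by eventually_elim (simp add: P_def)
    qed
  qed
  have "\<forall>\<^sub>F r in at_right 0. v r > 0 \<and> s r \<noteq> 0"
    using powr_law_pos[OF v0 eps(2) asym(2)] s_nonzero_near_0 by eventually_elim simp
  then obtain b where b: "b > 0" "\<And>r. 0 < r \<Longrightarrow> r < b \<Longrightarrow> v r > 0" "\<And>r. 0 < r \<Longrightarrow> r < b \<Longrightarrow> s r \<noteq> 0"
    unfolding eventually_at_right_field by blast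
  \<comment> \<open>Growth of \<open>e * P\<close> away from 0 is incompatible with the decay of
    \<open>P\<close> at infinity.\<close>
  have outer: False
    if e: "e = 1 \<or> e = (-1::real)"
      and xy: "\<And>r. 0 < r \<Longrightarrow> e * x r < 0" "\<And>r. 0 < r \<Longrightarrow> e * y r < 0" for e
  proof -
    obtain a where a: "e * P a > 0" "\<And>r. r \<ge> a \<Longrightarrow> e * P r \<ge> e * P a"
      using cone_growth[OF e xy b P0] by blast
    have "e * P a \<le> e * 0"
      by (rule tendsto_lowerbound[OF tendsto_mult_left[OF P_top] eventually_at_top_linorderI[OF a(2)]]) auto
    then show False using a(1) by simp
  qed
  have n0: "\<gamma> * real n > 0" using gamma n by simp
  have gn: "\<gamma> * real n \<le> real n" using gamma by (simp add: mult_left_le_one_le)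
  consider "m \<ge> 0" | "m < - 2 * int n" | "- 2 * int n \<le> m" "m < 0" by linarith
  then show False
  proof cases
    case 1
    show False
    proof (rule outer[of 1])
      fix r :: real assume r: "r > 0"
      have "(\<gamma> - 1) * Z r \<le> 0" using Z_nonneg[OF r] gamma by (simp add: mult_nonpos_nonneg)
      then have "r * x r < 0" using 1 n0 by (simp add: r_times_x[OF r])
      then show "1 * x r < 0" using r by (simp add: mult_less_0_iff)
      \<comment> \<open>For \<open>m = 0\<close> the strict inequality is essential, as
        \<open>r y\<close> is then \<open>\<gamma> * (Z - n)\<close>.\<close>
      have "\<gamma> * Z r < \<gamma> * n" using Z_less[OF r] gamma by simp
      then have "r * y r < 0" using 1 by (simp add: r_times_y[OF r])
      then show "1 * y r < 0" using r by (simp add: mult_less_0_iff)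
    qed simp
  next
    case 2
    then have m: "real_of_int m < - 2 * real n" by linarith
    show False
    proof (rule outer[of "-1"])
      fix r :: real assume r: "r > 0"
      \<comment> \<open>This bounds \<open>r x\<close> below by \<open>- n - m / 2\<close>, which is
        positive for \<open>m < - 2 n\<close>.\<close>
      have "(1 - \<gamma>) * Z r \<le> (1 - \<gamma>) * n" using Z_le[OF r] gamma by (intro mult_left_mono) auto
      then have "r * x r > 0" using m by (simp add: r_times_x[OF r] algebra_simps)
      then show "-1 * x r < 0" using r by (simp add: zero_less_mult_iff)
      have "\<gamma> * Z r \<ge> 0" using Z_nonneg[OF r] gamma by simp
      then have "r * y r > 0" using m gn by (simp add: r_times_y[OF r])
      then show "-1 * y r < 0" using r by (simp add: zero_less_mult_iff)
    qed simp
  next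
    case 3
    have "\<forall>\<^sub>F r in at_right 0. r * y r > 0"
      using 3 by (intro order_tendstoD(1)[OF r_times_y_at_0]) simp
    then have y_pos: "\<forall>\<^sub>F r in at_right 0. y r > 0"
      using eventually_at_right_less[of "0::real"] by eventually_elim (simp add: zero_less_mult_iff)
    have u_nonneg: "\<forall>\<^sub>F r in at_right 0. u r \<ge> 0"
    proof (cases "m = - 2 * int n")
      \<comment> \<open>Here the limit of \<open>r x\<close> is 0 and does not decide the sign of
        \<open>x\<close>. Instead \<open>u0 = 0\<close>, and by the multiplicative law
        \<open>u\<close> vanishes identically near 0.\<close>
      case True
      have "u0 = 0" by (rule leading_coefficient_zero[OF True k1 eps asym P0])
      then show ?thesis using asym(1) by (auto elim!: eventually_mono)
    next
      case False
      then have "real_of_int m > - 2 * real n" using 3 by linarith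
      then have "\<forall>\<^sub>F r in at_right 0. r * x r < 0"
        by (intro order_tendstoD(2)[OF r_times_x_at_0]) simp
      then have "\<forall>\<^sub>F r in at_right 0. x r < 0"
        using eventually_at_right_less[of "0::real"] by eventually_elim (simp add: mult_less_0_iff)
      then obtain c where c: "c > 0" "\<And>r. 0 < r \<Longrightarrow> r < c \<Longrightarrow> x r < 0"
        unfolding eventually_at_right_field by blast
      have "u r \<ge> 0" if r: "0 < r" "r < min b c" for r
      proof -
        have "P r > 0"
        proof (rule increasing_from_zero[OF P0 dP])
          show "0 < - 2 * x q * (s q)\<^sup>2 * Q q" if "0 < q" "q < min b c" for q
            using b(2,3)[of q] c(2)[of q] that
            by (auto simp: Q_def mult_less_0_iff)
        qed (use r in auto)
        moreover have "r * (s r)\<^sup>2 \<ge> 0" using r by simp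
        ultimately show ?thesis
          unfolding P_def by (meson less_imp_le linorder_not_less mult_nonneg_nonpos)
      qed
      moreover have "0 < min b c" using b(1) c(1) by simp
      ultimately show ?thesis unfolding eventually_at_right_field by blast
    qed
    have "\<forall>\<^sub>F r in at_right 0. y r > 0 \<and> u r \<ge> 0 \<and> v r > 0"
      using y_pos u_nonneg powr_law_pos[OF v0 eps(2) asym(2)] by eventually_elim simp
    then obtain c where c: "c > 0" "\<And>r. 0 < r \<Longrightarrow> r < c \<Longrightarrow> y r > 0 \<and> u r \<ge> 0 \<and> v r > 0"
      unfolding eventually_at_right_field by blast
    have "- Q (c / 2) \<ge> 0"
    proof (rule nondecreasing_from_zero[where f = "\<lambda>r. - Q r" and b = c])
      show "((\<lambda>r. - Q r) \<longlongrightarrow> 0) (at_right 0)" using tendsto_minus[OF Q0] by simp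
      fix r assume r: "0 < r" "r < c"
      have yuv: "y r > 0" "u r \<ge> 0" "v r > 0" using c(2)[OF r] by auto
      show "((\<lambda>r. - Q r) has_real_derivative
          - (\<gamma> * h r / y r * Q r - y r * (\<gamma> * (s r)\<^sup>2 / (2 * (y r)\<^sup>2) + 2) * (r * u r))) (at r)"
        using yuv by (intro DERIV_minus dQ r) simp
      have "\<gamma> * h r / y r \<le> 0"
        using h_nonpos[OF r(1)] yuv gamma by (simp add: divide_le_0_iff mult_le_0_iff)
      then have "\<gamma> * h r / y r * Q r \<le> 0"
        using r yuv by (intro mult_nonpos_nonneg) (simp_all add: Q_def)
      moreover have "0 \<le> y r * (\<gamma> * (s r)\<^sup>2 / (2 * (y r)\<^sup>2) + 2) * (r * u r)"
        using r yuv gamma by simp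
      ultimately show "0 \<le> - (\<gamma> * h r / y r * Q r
          - y r * (\<gamma> * (s r)\<^sup>2 / (2 * (y r)\<^sup>2) + 2) * (r * u r))" by simp
    qed (use c in auto)
    moreover have "Q (c / 2) > 0" using c(2)[of "c / 2"] c(1) by (simp add: Q_def)
    ultimately show False by simp
  qed
qed

lemma P_at_top:
  assumes "\<And>r. r \<ge> 1 \<Longrightarrow> \<bar>u r\<bar> \<le> C * r powr p * exp (- a * r)" and "a > 0"
  shows "(P \<longlongrightarrow> 0) at_top"
proof -
  have "((\<lambda>r. r * u r) \<longlongrightarrow> 0) at_top"
  proof (rule Lim_null_comparison)
    show "\<forall>\<^sub>F r in at_top. norm (r * u r) \<le> C * r powr (p + 1) * exp (- a * r)"
      using eventually_ge_at_top[of 1]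
    proof eventually_elim
      case (elim r)
      then have "r * \<bar>u r\<bar> \<le> r * (C * r powr p * exp (- a * r))" by (intro mult_left_mono assms) auto
      then show ?case using elim by (simp add: abs_mult powr_add mult_ac)
    qed
  qed (rule exp_decay_at_top[OF assms(2)])
  then have "((\<lambda>r. (s r)\<^sup>2 * (r * u r)) \<longlongrightarrow> 1\<^sup>2 * 0) at_top"
    by (intro tendsto_intros s_at_top)
  then show ?thesis by (simp add: P_def[abs_def] mult_ac)
qed

text \<open>Where \<open>v\<close> and \<open>v'\<close> vanish, the constraint is \<open>u\<close>
  times a coefficient that is positive because \<open>s\<close> is nonzero near 0.\<close>

lemma v_zero_imp_u_zero:
  assumes v: "\<forall>\<^sub>F r in at_right 0. v r = 0"
  shows "\<forall>\<^sub>F r in at_right 0. u r = 0 \<and> v r = 0"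
proof -
  obtain b where b: "b > 0" "\<And>r. 0 < r \<Longrightarrow> r < b \<Longrightarrow> v r = 0 \<and> s r \<noteq> 0"
    using eventually_conj[OF v s_nonzero_near_0] unfolding eventually_at_right_field by blast
  have "u r = 0 \<and> v r = 0" if r: "0 < r" "r < b" for r
  proof -
    have "(v has_real_derivative 0) (at r)"
      by (rule has_field_derivative_transform_within_open[of "\<lambda>_. 0" _ _ "{0<..<b}"])
        (use b(2) r in auto)
    then have "v' r = 0" using DERIV_unique dv[OF r(1)] by blast
    then have "(2 * (y r)\<^sup>2 + \<gamma> / 2 * (s r)\<^sup>2) * u r = 0"
      using eq_u[OF r(1)] b(2)[OF r] by simp
    moreover have "2 * (y r)\<^sup>2 + \<gamma> / 2 * (s r)\<^sup>2 > 0"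
      using b(2)[OF r] gamma by (intro add_nonneg_pos) auto
    ultimately show ?thesis using b(2)[OF r] by auto
  qed
  then show ?thesis using b(1) unfolding eventually_at_right_field by blast
qed

text \<open>The system is linear, so the case \<open>v0 < 0\<close> reduces to
  \<open>v0 > 0\<close>. With the derivatives as locale parameters, the negated data form an
  instance directly.\<close>

lemma W_field_uminus: "W_field n \<beta> s z \<gamma> m (\<lambda>r. - u r) (\<lambda>r. - v r) (\<lambda>r. - u' r) (\<lambda>r. - v' r) (\<lambda>r. - v'' r)"
proof unfold_locales
  fix r :: real assume r: "0 < r"
  show "- v'' r + - v' r / r - - v r / r\<^sup>2 + 2 * (2 * deriv y r * - u r + y r * - u' r
      + y r * - u r / r) - \<gamma> * - v r * (s r)\<^sup>2 = 0"
    using eq_v[OF r] by (simp add: algebra_simps)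
  show "- v' r * y r - - v r * deriv y r + (2 * (y r)\<^sup>2 + \<gamma> / 2 * (s r)\<^sup>2) * - u r = 0"
    using eq_u[OF r] by (simp add: algebra_simps)
qed (use gamma in \<open>auto intro!: DERIV_minus du dv dv'\<close>)

end

theorem theorem3:
  fixes n :: nat and \<beta> \<gamma> :: real and s z :: "real \<Rightarrow> real"
  assumes "n \<ge> 1" and "\<beta> > 0" and "0 < \<gamma>" and "\<gamma> \<le> 1"
    and "NO_vortex n \<beta> s z"
  shows "\<not> (\<exists>(m::int) u v. W_perturbation \<gamma> n m s z u v)"
proof
  assume "\<exists>(m::int) u v. W_perturbation \<gamma> n m s z u v"
  then obtain m u v where W: "W_perturbation \<gamma> n m s z u v" by blast
  note W' = W[unfolded W_perturbation_def Let_def]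
  interpret W_field n \<beta> s z \<gamma> m u v "deriv u" "deriv v" "deriv (deriv v)"
    by unfold_locales
      (use assms W' in \<open>simp_all add: DERIV_deriv_iff_real_differentiable\<close>)
  obtain k u0 v0 \<epsilon>u \<epsilon>v where k: "k > - 1 / 2"
    and eps: "(\<epsilon>u \<longlongrightarrow> 0) (at_right 0)" "(\<epsilon>v \<longlongrightarrow> 0) (at_right 0)"
    and asym: "\<forall>\<^sub>F r in at_right 0. u r = u0 * r powr k * (1 + \<epsilon>u r) \<and>
      v r = v0 * r powr k * (1 + \<epsilon>v r)"
    using W' by blast
  have asym': "\<forall>\<^sub>F r in at_right 0. u r = u0 * r powr k * (1 + \<epsilon>u r)"
    "\<forall>\<^sub>F r in at_right 0. v r = v0 * r powr k * (1 + \<epsilon>v r)"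
    using asym by (auto elim: eventually_mono)
  obtain C p where decay: "\<And>r. r \<ge> 1 \<Longrightarrow> \<bar>u r\<bar> \<le> C * r powr p * exp (- sqrt \<gamma> * r)"
    using W' by blast
  have sqrt_pos: "sqrt \<gamma> > 0" using assms by simp
  consider "v0 > 0" | "v0 < 0" | "v0 = 0" by linarith
  then show False
  proof cases
    case 1
    show False by (rule no_solution_with_positive_v0[OF k eps asym' 1 P_at_top[OF decay sqrt_pos]])
  next
    case 2
    interpret neg: W_field n \<beta> s z \<gamma> m "\<lambda>r. - u r" "\<lambda>r. - v r" "\<lambda>r. - deriv u r" "\<lambda>r. - deriv v r"
      "\<lambda>r. - deriv (deriv v) r"
      by (rule W_field_uminus)
    show False
    proof (rule neg.no_solution_with_positive_v0[OF k eps])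
      show "\<forall>\<^sub>F r in at_right 0. - u r = - u0 * r powr k * (1 + \<epsilon>u r)"
        "\<forall>\<^sub>F r in at_right 0. - v r = - v0 * r powr k * (1 + \<epsilon>v r)"
        using asym' by (auto elim!: eventually_mono)
      show "(neg.P \<longlongrightarrow> 0) at_top"
        by (rule neg.P_at_top[OF _ sqrt_pos]) (use decay in simp)
    qed (use 2 in simp)
  next
    \<comment> \<open>With \<open>v0 = 0\<close> the law gives \<open>v = 0\<close> exactly on an
      interval at 0; both fields then vanish there, and \<open>uniqueness\<close> propagates this to
      all radii.\<close>
    case 3
    then have "\<forall>\<^sub>F r in at_right 0. v r = 0" using asym'(2) by simp
    then obtain b where "b > 0" "\<And>r. 0 < r \<Longrightarrow> r < b \<Longrightarrow> u r = 0 \<and> v r = 0"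
      using v_zero_imp_u_zero unfolding eventually_at_right_field by blast
    then have "u r = 0 \<and> v r = 0" if "r > 0" for r using uniqueness that by blast
    then show False using W' by blast
  qed
qed

end
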